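(* For every $k\in\mathbb{Z}^+$, we have $HJ(k,2)\le k$.
   Context: For $k\in\mathbb{Z}^+$ let $[k]=\{1,2,\dots,k\}$. A variable word over $[k]$ of length $n$ is a vector $w(x)\in([k]\cup\{x\})^n$ containing at least one occurrence of $x$; for $a\in[k]$, $w(a)\in[k]^n$ is obtained by replacing every occurrence of $x$ by $a$. The combinatorial line determined by $w(x)$ is $\{w(a):a\in[k]\}$. A (combinatorial) $m$-line (partial combinatorial line of length $m$) in $[k]^n$ is a set of the form $\{w(a):a\in\{i+1,\dots,i+m\}\}$ with $w(x)$ a variable word and $0\le i\le k-m$. For $k_1,k_2\in\mathbb{Z}^+$ and $K=\max(k_1,k_2)$, the off-diagonal Hales-Jewett number $HJ(k_1,k_2)=HJ(k_1,k_2;2)$ is the least positive integer $n$ such that every $2$-coloring of $[K]^n$ contains a monochromatic $k_1$-line of color $1$ or a monochromatic $k_2$-line of color $2$. *)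

theory Defs
  imports Main "HOL-Library.FuncSet" "HOL-Library.Extended_Nat"
begin

definition words :: "nat \<Rightarrow> nat \<Rightarrow> nat list set" where
  "words k n = {u. length u = n \<and> set u \<subseteq> {1..k}}"

text \<open>In a variable word, \<open>None\<close> stands for the variable \<open>x\<close> and \<open>Some a\<close> for the letter \<open>a\<close>.\<close>

definition variable_words :: "nat \<Rightarrow> nat \<Rightarrow> nat option list set" where
  "variable_words k n =
     {w. length w = n \<and> set w \<subseteq> insert None (Some ` {1..k}) \<and> None \<in> set w}"

definition subst_word :: "nat option list \<Rightarrow> nat \<Rightarrow> nat list" where
  "subst_word w a = map (\<lambda>s. case s of None \<Rightarrow> a | Some b \<Rightarrow> b) w"

text \<open>The condition \<open>i + m \<le> k\<close> expresses \<open>0 \<le> i \<le> k - m\<close> for integers, avoiding truncated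
  subtraction; in particular there are no \<open>m\<close>-lines when \<open>m > k\<close>.\<close>

definition lines :: "nat \<Rightarrow> nat \<Rightarrow> nat \<Rightarrow> nat list set set" where
  "lines k n m =
     {L. \<exists>w\<in>variable_words k n. \<exists>i. i + m \<le> k \<and> L = subst_word w ` {i + 1..i + m}}"

definition HJ_property :: "nat \<Rightarrow> nat \<Rightarrow> nat \<Rightarrow> bool" where
  "HJ_property k1 k2 n \<longleftrightarrow>
     (\<forall>c :: nat list \<Rightarrow> nat. c \<in> words (max k1 k2) n \<rightarrow> {1, 2} \<longrightarrow>
        (\<exists>L\<in>lines (max k1 k2) n k1. \<forall>u\<in>L. c u = 1) \<or>
        (\<exists>L\<in>lines (max k1 k2) n k2. \<forall>u\<in>L. c u = 2))"

text \<open>The infimum in \<^typ>\<open>enat\<close> of a nonempty set of naturals is its least element, and it is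
  \<open>\<infinity>\<close> for the empty set. Hence a finite upper bound on \<open>HJ\<close> includes the claim that a suitable
  dimension exists, which would not be so for \<open>LEAST\<close> on \<^typ>\<open>nat\<close>.\<close>

definition HJ :: "nat \<Rightarrow> nat \<Rightarrow> enat" where
  "HJ k1 k2 = Inf {enat n | n. n > 0 \<and> HJ_property k1 k2 n}"

end

theory Submission imports Defs begin

text \<open>
  For \<open>k = 1\<close> the alphabet is \<open>[2]\<close>: one letter of colour 1 already is a 1-line, and without one the
  two letters form a 2-line of colour 2. Let \<open>k \<ge> 2\<close> and consider a colouring of \<open>[k]^k\<close>. Suppose
  that no combinatorial line is entirely of colour 1, so that every variable word takes colour 2 at
  some letter, and that no 2-line is entirely of colour 2.

  The diagonal takes colour 2 at some constant word \<open>c^k\<close>. Choose a letter \<open>d\<close> next to \<open>c\<close> and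
  look at the \<open>k\<close> variable words \<open>c^i d^(k-1-i) x\<close> with \<open>i < k\<close>. For a fixed value of \<open>x\<close>, any two of
  them form a 2-line, because they differ by exchanging \<open>c\<close> and \<open>d\<close> in one block. Hence the letters
  at which these \<open>k\<close> variable words take colour 2 are pairwise different, and by counting every
  letter occurs, in particular \<open>d\<close>. So some \<open>c^i d^(k-i)\<close> with \<open>i < k\<close> has colour 2; but it forms
  a 2-line with \<open>c^k\<close>, a contradiction. Counting \<open>k + 1\<close> variable words in dimension \<open>k + 1\<close> would
  be the plain pigeonhole argument; the diagonal saves one dimension.
\<close>

lemma subst_word_append [simp]: "subst_word (u @ v) a = subst_word u a @ subst_word v a"
  and subst_word_replicate_None [simp]: "subst_word (replicate m None) a = replicate m a"
  and subst_word_replicate_Some [simp]: "subst_word (replicate m (Some b)) a = replicate m b"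
  and subst_word_Nil [simp]: "subst_word [] a = []"
  and subst_word_None [simp]: "subst_word (None # u) a = a # subst_word u a"
  and subst_word_Some [simp]: "subst_word (Some b # u) a = b # subst_word u a"
  by (simp_all add: subst_word_def)

lemma subst_word_in_words:
  assumes "w \<in> variable_words k n" "a \<in> {1..k}"
  shows "subst_word w a \<in> words k n"
  using assms by (fastforce simp: variable_words_def words_def subst_word_def split: option.splits)

text \<open>The two letters may come in either order, so that a letter \<open>c\<close> can be compared with whichever
  neighbour exists in \<open>[k]\<close>.\<close>

lemma adjacent_letters_2_line:
  assumes w: "w \<in> variable_words k n" and "c \<in> {1..k}" "d \<in> {1..k}" "d = Suc c \<or> c = Suc d"
  shows "{subst_word w c, subst_word w d} \<in> lines k n 2"
proof -
  obtain i where i: "i + 2 \<le> k" "{c, d} = {i + 1, i + 2}"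
  proof (cases "d = Suc c")
    case True
    then show ?thesis using that[of "c - 1"] assms(2-4) by auto
  next
    case False
    then show ?thesis using that[of "d - 1"] assms(2-4) by auto
  qed
  have "{i + 1..i + 2} = {c, d}"
    unfolding i(2) by auto
  then have "subst_word w ` {i + 1..i + 2} = {subst_word w c, subst_word w d}"
    by simp
  then show ?thesis
    unfolding lines_def using w i(1) by blast
qed

text \<open>The diagonal argument, with \<open>A\<close> in the role of the words of colour 2.\<close>

lemma set_meeting_every_line_contains_2_line:
  assumes "k \<ge> 2"
    and hit: "\<And>w. w \<in> variable_words k k \<Longrightarrow> \<exists>a\<in>{1..k}. subst_word w a \<in> A"
  shows "\<exists>L\<in>lines k k 2. L \<subseteq> A"
proof (rule ccontr)
  assume no_line: "\<not> ?thesis"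
  have "replicate k None \<in> variable_words k k"
    using \<open>k \<ge> 2\<close> by (auto simp: variable_words_def)
  from hit[OF this] obtain c where c: "c \<in> {1..k}" "replicate k c \<in> A"
    by auto
  define d where "d = (if c < k then Suc c else c - 1)"
  have d: "d \<in> {1..k}" "d = Suc c \<or> c = Suc d"
    using c(1) \<open>k \<ge> 2\<close> by (auto simp: d_def)
  have not_both: "\<not> (subst_word w c \<in> A \<and> subst_word w d \<in> A)" if "w \<in> variable_words k k" for w
    using adjacent_letters_2_line[OF that c(1) d] no_line by auto

  define W where "W i = replicate i (Some c) @ replicate (k - 1 - i) (Some d) @ [None]" for i
  have W: "W i \<in> variable_words k k" if "i < k" for i
    using that c(1) d(1) by (auto simp: W_def variable_words_def)
  obtain f where f: "\<And>i. i < k \<Longrightarrow> f i \<in> {1..k} \<and> subst_word (W i) (f i) \<in> A"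
    using hit[OF W] by metis
  have f_neq: "f i \<noteq> f j" if "i < j" "j < k" for i j
  proof
    assume eq: "f i = f j"
    \<comment> \<open>The variable marks the block where the two words differ; their common last letter is fixed.\<close>
    define w where "w = replicate i (Some c) @ replicate (j - i) None
                          @ replicate (k - 1 - j) (Some d) @ [Some (f j)]"
    have "w \<in> variable_words k k"
      using that c(1) d(1) f[of j] by (auto simp: w_def variable_words_def)
    moreover have "subst_word w c = subst_word (W j) (f j)"
      using that by (simp add: w_def W_def replicate_add[symmetric] flip: append_assoc)
    moreover have "subst_word w d = subst_word (W i) (f i)"
    proof -
      have "k - Suc i = (j - i) + (k - Suc j)"
        using that by simp
      then show ?thesis
        by (simp add: w_def W_def eq replicate_add)
    qed
    ultimately show False
      using not_both f that by (metis order_less_trans)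
  qed
  have "inj_on f {..<k}"
    by (rule linorder_inj_onI) (use f_neq in auto)
  then have "f ` {..<k} = {1..k}"
    using f by (intro card_subset_eq) (auto simp: card_image)
  then obtain i where i: "i < k" "f i = d"
    using d(1) by (metis imageE lessThan_iff)

  define w where "w = replicate i (Some c) @ replicate (k - i) None"
  have "w \<in> variable_words k k"
    using i(1) c(1) by (auto simp: w_def variable_words_def)
  moreover have "subst_word w c = replicate k c"
    using i(1) by (simp add: w_def flip: replicate_add)
  moreover have "subst_word w d = subst_word (W i) (f i)"
  proof -
    have "k - i = Suc (k - Suc i)"
      using i(1) by simp
    then show ?thesis
      by (simp add: w_def W_def i(2) replicate_append_same)
  qed
  ultimately show False
    using not_both c(2) f[OF i(1)] by metis
qed

lemma HJ_property_2_of_ge_2: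
  assumes "k \<ge> 2"
  shows "HJ_property k 2 k"
  unfolding HJ_property_def
proof (intro allI impI)
  fix col :: "nat list \<Rightarrow> nat"
  assume "col \<in> words (max k 2) k \<rightarrow> {1, 2}"
  then have col: "col u = 1 \<or> col u = 2" if "u \<in> words k k" for u
    using that \<open>k \<ge> 2\<close> by (auto simp: max_def)
  show "(\<exists>L\<in>lines (max k 2) k k. \<forall>u\<in>L. col u = 1) \<or> (\<exists>L\<in>lines (max k 2) k 2. \<forall>u\<in>L. col u = 2)"
  proof (cases "\<exists>L\<in>lines k k k. \<forall>u\<in>L. col u = 1")
    case True
    then show ?thesis using \<open>k \<ge> 2\<close> by (simp add: max_def)
  next
    case False
    have "\<exists>a\<in>{1..k}. subst_word w a \<in> {u. col u = 2}" if w: "w \<in> variable_words k k" for w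
    proof (rule ccontr)
      assume "\<not> ?thesis"
      then have "\<forall>u\<in>subst_word w ` {1..k}. col u = 1"
        using col subst_word_in_words[OF w] by blast
      moreover have "subst_word w ` {1..k} \<in> lines k k k"
        using w by (auto simp: lines_def)
      ultimately show False using False by blast
    qed
    from set_meeting_every_line_contains_2_line[OF \<open>k \<ge> 2\<close> this]
    show ?thesis using \<open>k \<ge> 2\<close> by (auto simp: max_def)
  qed
qed

lemma HJ_property_1_2_1: "HJ_property 1 2 1"
  unfolding HJ_property_def
proof (intro allI impI)
  fix col :: "nat list \<Rightarrow> nat"
  assume "col \<in> words (max 1 2) 1 \<rightarrow> {1, 2}"
  then have col: "col [a] = 1 \<or> col [a] = 2" if "a \<in> {1, 2}" for a
  proof -
    have "[a] \<in> words (max 1 2) 1"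
      using that by (auto simp: words_def)
    then show ?thesis
      using \<open>col \<in> _\<close> by blast
  qed
  have x: "[None] \<in> variable_words 2 1"
    by (simp add: variable_words_def)
  have "{[1]} \<in> lines 2 1 1"
    unfolding lines_def by (intro CollectI bexI[OF _ x] exI[of _ 0]) simp
  moreover have "{[2]} \<in> lines 2 1 1"
    unfolding lines_def by (intro CollectI bexI[OF _ x] exI[of _ 1]) (simp add: numeral_2_eq_2)
  moreover have "{[1], [2]} \<in> lines 2 1 2"
    using adjacent_letters_2_line[OF x, of 1 2] by simp
  ultimately have "(\<exists>L\<in>lines 2 1 1. \<forall>u\<in>L. col u = 1) \<or> (\<exists>L\<in>lines 2 1 2. \<forall>u\<in>L. col u = 2)"
    using col by (metis empty_iff insert_iff)
  then show "(\<exists>L\<in>lines (max 1 2) 1 1. \<forall>u\<in>L. col u = 1)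
      \<or> (\<exists>L\<in>lines (max 1 2) 1 2. \<forall>u\<in>L. col u = 2)"
    by (simp add: numeral_2_eq_2)
qed

theorem theorem12:
  fixes k :: nat
  assumes "k \<ge> 1"
  shows "HJ k 2 \<le> enat k"
proof -
  have "HJ_property k 2 k"
  proof (cases "k = 1")
    case True
    then show ?thesis using HJ_property_1_2_1 by simp
  next
    case False
    then show ?thesis using assms by (intro HJ_property_2_of_ge_2) simp
  qed
  then show ?thesis
    unfolding HJ_def using assms by (intro Inf_lower) auto
qed

end
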